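(* Let $V$ be a finite set, let $S$ be a set of separations of $V$, let $\tau$ be a tangle of $S$, and let $m$ be the number of maximal elements of $\tau$. If $\tau$ is $k$-resilient for some integer $k>\frac m2$, then there is a function $w\colon V\to\mathbb{R}_{\ge 0}$ that induces $\tau$.
   Context: A separation of a finite set $V$ is an unordered pair $\{A,B\}$ of subsets of $V$ with $A\cup B=V$. Its two orientations are the ordered pairs $(A,B)$ and $(B,A)$, which are inverses of each other; they coincide if and only if $A=B=V$. For an oriented separation $(A,B)$, $A$ is its small side and $B$ its big side. Oriented separations are partially ordered by $(A,B)\le (C,D)$ if and only if $A\subseteq C$ and $B\supseteq D$. Maximal elements of a set of oriented separations are those maximal in this order. An orientation of a set $S$ of (unoriented) separations of $V$ is a set $\tau$ consisting of exactly one orientation of each $s\in S$ (and nothing else). It is consistent if there are no two $(A,B),(C,D)\in\tau$ with $(B,A)<(C,D)$. A tangle of $S$ is a consistent orientation $\tau$ of $S$ such that there are no (not necessarily distinct) $(A_1,B_1),(A_2,B_2),(A_3,B_3)\in\tau$ with $A_1\cup A_2\cup A_3=V$. For $k\in\mathbb{N}$, an orientation $\tau$ of $S$ is $k$-resilient if $\bigcup_{(A,B)\in\sigma}A\neq V$ for every set $\sigma\subseteq\tau$ of size at most $k$. For $w\colon V\to\mathbb{R}_{\ge0}$ and $Z\subseteq V$ write $w(Z)=\sum_{v\in Z}w(v)$. The function $w$ induces an orientation $\tau$ of $S$ if $w(A)<w(B)$ for all $(A,B)\in\tau$. *)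

theory Defs
  imports Complex_Main
begin

text \<open>
  An unoriented separation is the set \<open>{A, B}\<close> of its two sides, so it is the singleton
  \<open>{V}\<close> if \<open>A = B = V\<close>; an oriented separation is an ordered pair.
\<close>

type_synonym 'a separation = "'a set set"
type_synonym 'a oriented_separation = "'a set \<times> 'a set"

definition is_separation :: "'a set \<Rightarrow> 'a separation \<Rightarrow> bool" where
  "is_separation V s \<longleftrightarrow> (\<exists>A B. A \<subseteq> V \<and> B \<subseteq> V \<and> A \<union> B = V \<and> s = {A, B})"

definition orientations :: "'a separation \<Rightarrow> 'a oriented_separation set" where
  "orientations s = {(A, B). s = {A, B}}"

definition sep_le :: "'a oriented_separation \<Rightarrow> 'a oriented_separation \<Rightarrow> bool" where
  "sep_le = (\<lambda>(A, B) (C, D). A \<subseteq> C \<and> D \<subseteq> B)"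

definition sep_less :: "'a oriented_separation \<Rightarrow> 'a oriented_separation \<Rightarrow> bool" where
  "sep_less p q \<longleftrightarrow> sep_le p q \<and> p \<noteq> q"

definition maximal_elements :: "'a oriented_separation set \<Rightarrow> 'a oriented_separation set" where
  "maximal_elements \<tau> = {p \<in> \<tau>. \<not> (\<exists>q \<in> \<tau>. sep_less p q)}"

definition is_orientation :: "'a separation set \<Rightarrow> 'a oriented_separation set \<Rightarrow> bool" where
  "is_orientation S \<tau> \<longleftrightarrow>
     (\<forall>s \<in> S. \<exists>!p. p \<in> \<tau> \<and> p \<in> orientations s) \<and>
     (\<forall>p \<in> \<tau>. \<exists>s \<in> S. p \<in> orientations s)"

text \<open>
  The two elements in the next definition are distinct. This makes no difference for tangles:
  \<open>(B, A) < (A, B)\<close> forces \<open>A = V\<close>, which the covering condition for tangles forbids.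
\<close>

definition consistent :: "'a oriented_separation set \<Rightarrow> bool" where
  "consistent \<tau> \<longleftrightarrow>
     \<not> (\<exists>A B C D. (A, B) \<in> \<tau> \<and> (C, D) \<in> \<tau> \<and> (A, B) \<noteq> (C, D) \<and> sep_less (B, A) (C, D))"

definition is_tangle ::
    "'a set \<Rightarrow> 'a separation set \<Rightarrow> 'a oriented_separation set \<Rightarrow> bool" where
  "is_tangle V S \<tau> \<longleftrightarrow>
     is_orientation S \<tau> \<and> consistent \<tau> \<and>
     \<not> (\<exists>A1 B1 A2 B2 A3 B3. (A1, B1) \<in> \<tau> \<and> (A2, B2) \<in> \<tau> \<and> (A3, B3) \<in> \<tau> \<and>
          A1 \<union> A2 \<union> A3 = V)"

definition resilient :: "'a set \<Rightarrow> nat \<Rightarrow> 'a oriented_separation set \<Rightarrow> bool" where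
  "resilient V k \<tau> \<longleftrightarrow>
     (\<forall>\<sigma>. \<sigma> \<subseteq> \<tau> \<and> finite \<sigma> \<and> card \<sigma> \<le> k \<longrightarrow> (\<Union>(A, B)\<in>\<sigma>. A) \<noteq> V)"

definition induces :: "('a \<Rightarrow> real) \<Rightarrow> 'a oriented_separation set \<Rightarrow> bool" where
  "induces w \<tau> \<longleftrightarrow> (\<forall>(A, B) \<in> \<tau>. sum w A < sum w B)"

end

theory Submission
  imports Defs
begin

text \<open>
  Weights are monotone, so it suffices to find a weight function that induces the set \<open>M\<close> of
  the maximal elements of \<open>\<tau>\<close> (lemma \<open>induces_if_induces_maximal\<close>). Put \<open>r = min k m\<close>. By
  resilience, every \<open>r\<close>-subset \<open>\<sigma>\<close> of \<open>M\<close> leaves some point \<open>x \<sigma>\<close> of \<open>V\<close> outside all small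
  sides of elements of \<open>\<sigma>\<close>. Let \<open>w v\<close> be the number of \<open>r\<close>-subsets \<open>\<sigma>\<close> with \<open>x \<sigma> = v\<close>.

  Fix \<open>(A, B) \<in> M\<close>. An \<open>r\<close>-subset that contains \<open>(A, B)\<close> has its point outside \<open>A\<close>, hence in
  \<open>B\<close>; so \<open>w(B)\<close> is at least the number of \<open>r\<close>-subsets that contain \<open>(A, B)\<close>, and \<open>w(A)\<close> is at
  most the number of those that avoid it. The former number is the larger one precisely because
  \<open>2 * r > m\<close> (lemma \<open>more_subsets_contain_than_avoid\<close>): an element lies in the fraction
  \<open>r / m\<close> of all \<open>r\<close>-subsets of an \<open>m\<close>-element set.
\<close>

section \<open>Reduction to the maximal elements\<close>

lemma below_maximal_element:
  assumes "finite \<tau>" and "p \<in> \<tau>"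
  obtains q where "q \<in> maximal_elements \<tau>" and "sep_le p q"
proof -
  have "asymp_on \<tau> sep_less"
    by (auto simp: asymp_on_def sep_less_def sep_le_def)
  moreover have "transp_on \<tau> sep_less"
    by (auto simp: transp_on_def sep_less_def sep_le_def)
  moreover have "\<exists>q \<in> \<tau>. sep_le p q"
    using assms(2) by (auto simp: sep_le_def split: prod.splits)
  ultimately have "\<exists>q \<in> \<tau>. sep_le p q \<and> (\<forall>q' \<in> \<tau>. sep_less q q' \<longrightarrow> \<not> sep_le p q')"
    by (rule Finite_Set.bex_max_element_with_property[OF assms(1)])
  then obtain q where q: "q \<in> \<tau>" "sep_le p q"
      and max: "\<And>q'. q' \<in> \<tau> \<Longrightarrow> sep_less q q' \<Longrightarrow> \<not> sep_le p q'"
    by blast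
  have "\<not> sep_less q q'" if "q' \<in> \<tau>" for q'
    using max[OF that] q(2) by (auto simp: sep_less_def sep_le_def split: prod.splits)
  then have "q \<in> maximal_elements \<tau>"
    using q(1) unfolding maximal_elements_def by blast
  then show ?thesis
    using q(2) by (rule that)
qed

text \<open>
  Going down in the order shrinks the small side and enlarges the big one, which only widens the
  gap between their weights.
\<close>

lemma induces_if_induces_maximal:
  assumes "finite V" and "\<tau> \<subseteq> Pow V \<times> Pow V"
    and nonneg: "\<forall>v \<in> V. 0 \<le> w v"
    and max: "induces w (maximal_elements \<tau>)"
  shows "induces w \<tau>"
  unfolding induces_def
proof safe
  fix A B assume AB: "(A, B) \<in> \<tau>"
  have "finite \<tau>"
    using assms(1,2) by (meson finite_Pow_iff finite_SigmaI finite_subset)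
  then obtain q where "q \<in> maximal_elements \<tau>" "sep_le (A, B) q"
    using below_maximal_element[OF _ AB] by blast
  then obtain C D where CD: "(C, D) \<in> maximal_elements \<tau>" and le: "A \<subseteq> C" "D \<subseteq> B"
    by (cases q) (auto simp: sep_le_def)
  have sub: "C \<subseteq> V" "B \<subseteq> V"
    using CD AB assms(2) by (auto simp: maximal_elements_def)
  have "sum w A \<le> sum w C"
    using le sub nonneg assms(1) by (intro sum_mono2) (auto intro: finite_subset)
  also have "\<dots> < sum w D"
    using max CD by (auto simp: induces_def)
  also have "\<dots> \<le> sum w B"
    using le sub nonneg assms(1) by (intro sum_mono2) (auto intro: finite_subset)
  finally show "sum w A < sum w B" .
qed

lemma orientation_sides:
  assumes "is_orientation S \<tau>" and "\<forall>s \<in> S. is_separation V s" and "(A, B) \<in> \<tau>"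
  shows "A \<union> B = V"
proof -
  obtain s where "s \<in> S" and s: "s = {A, B}"
    using assms(1,3) unfolding is_orientation_def orientations_def by blast
  have "is_separation V s"
    using assms(2) \<open>s \<in> S\<close> by blast
  then obtain C D where "C \<union> D = V" and "s = {C, D}"
    unfolding is_separation_def by (elim exE conjE)
  moreover have "\<Union>s = A \<union> B"
    unfolding s by simp
  moreover have "\<Union>s = C \<union> D"
    unfolding \<open>s = {C, D}\<close> by simp
  ultimately show ?thesis
    by argo
qed

section \<open>Counting subsets and weights\<close>

text \<open>
  For \<open>n = card M - 1\<close>, the two families have \<open>n choose r\<close> and \<open>n choose (r - 1)\<close> elements, and
  binomial coefficients decrease strictly beyond the middle of their row.
\<close>

lemma more_subsets_contain_than_avoid:
  assumes "finite M" and "p \<in> M" and "r \<le> card M" and "card M < 2 * r"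
  shows "card {\<sigma>. \<sigma> \<subseteq> M \<and> card \<sigma> = r \<and> p \<notin> \<sigma>} < card {\<sigma>. \<sigma> \<subseteq> M \<and> card \<sigma> = r \<and> p \<in> \<sigma>}"
proof -
  obtain j where r: "r = Suc j"
    using assms(4) by (cases r) auto
  define n where "n = card (M - {p})"
  have n: "card M = Suc n"
    using assms(1,2) unfolding n_def by (metis card_Suc_Diff1)
  have "{\<sigma>. \<sigma> \<subseteq> M \<and> card \<sigma> = r \<and> p \<notin> \<sigma>} = {\<sigma>. \<sigma> \<subseteq> M - {p} \<and> card \<sigma> = r}"
    by auto
  then have avoid: "card {\<sigma>. \<sigma> \<subseteq> M \<and> card \<sigma> = r \<and> p \<notin> \<sigma>} = n choose Suc j"
    using assms(1) by (simp add: n_subsets n_def r)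
  have "bij_betw (insert p) {\<sigma>. \<sigma> \<subseteq> M - {p} \<and> card \<sigma> = j}
          {\<sigma>. \<sigma> \<subseteq> M \<and> card \<sigma> = r \<and> p \<in> \<sigma>}"
  proof (rule bij_betw_byWitness[where f' = "\<lambda>\<sigma>. \<sigma> - {p}"])
    show "insert p ` {\<sigma>. \<sigma> \<subseteq> M - {p} \<and> card \<sigma> = j} \<subseteq> {\<sigma>. \<sigma> \<subseteq> M \<and> card \<sigma> = r \<and> p \<in> \<sigma>}"
    proof safe
      fix \<sigma> assume "\<sigma> \<subseteq> M - {p}" "j = card \<sigma>"
      moreover then have "finite \<sigma>" "p \<notin> \<sigma>"
        using assms(1) by (auto intro: finite_subset)
      ultimately show "card (insert p \<sigma>) = r"
        by (simp add: r)
    qed (use assms(2) in auto)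
    show "(\<lambda>\<sigma>. \<sigma> - {p}) ` {\<sigma>. \<sigma> \<subseteq> M \<and> card \<sigma> = r \<and> p \<in> \<sigma>} \<subseteq> {\<sigma>. \<sigma> \<subseteq> M - {p} \<and> card \<sigma> = j}"
      by (auto simp: r)
  qed auto
  then have contain: "card {\<sigma>. \<sigma> \<subseteq> M \<and> card \<sigma> = r \<and> p \<in> \<sigma>} = n choose j"
    using assms(1) by (simp add: n_subsets n_def bij_betw_same_card[symmetric])
  have "n choose Suc j < n choose j"
  proof (cases "j = n")
    case False
    then show ?thesis
      using assms(3,4) n r by (intro binomial_strict_antimono) auto
  qed simp
  then show ?thesis
    unfolding avoid contain .
qed

text \<open>
  A weight that counts the points \<open>x i\<close> with multiplicity gives a set the number of indices whose
  point lies in it.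
\<close>

lemma sum_card_fibres:
  assumes "finite I" and "finite A"
  shows "(\<Sum>v\<in>A. real (card {i \<in> I. x i = v})) = real (card {i \<in> I. x i \<in> A})"
proof -
  have "(\<Sum>v\<in>A. card {i \<in> I. x i = v}) = (\<Sum>v\<in>A. card {i \<in> {i \<in> I. x i \<in> A}. x i = v})"
    by (intro sum.cong refl arg_cong[where f = card]) auto
  also have "\<dots> = card {i \<in> I. x i \<in> A}"
    using sum.group[of "{i \<in> I. x i \<in> A}" A x "\<lambda>_. 1::nat"] assms by force
  finally show ?thesis
    by (simp flip: of_nat_sum)
qed

section \<open>Resilient tangles are induced by weights\<close>

theorem theorem1:
  fixes V :: "'a set"
    and S :: "'a separation set"
    and \<tau> :: "'a oriented_separation set"
    and m k :: nat
  assumes "finite V"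
    and "\<forall>s \<in> S. is_separation V s"
    and "is_tangle V S \<tau>"
    and "m = card (maximal_elements \<tau>)"
    and "resilient V k \<tau>"
    and "real k > real m / 2"
  shows "\<exists>w :: 'a \<Rightarrow> real. (\<forall>v \<in> V. 0 \<le> w v) \<and> induces w \<tau>"
proof -
  have sides: "A \<union> B = V" if "(A, B) \<in> \<tau>" for A B
    using orientation_sides assms(2,3) that unfolding is_tangle_def by blast
  then have sub: "\<tau> \<subseteq> Pow V \<times> Pow V"
    by auto
  define M where "M = maximal_elements \<tau>"
  have "M \<subseteq> \<tau>"
    by (auto simp: M_def maximal_elements_def)
  then have "finite M"
    using assms(1) sub by (meson finite_Pow_iff finite_SigmaI finite_subset)
  \<comment> \<open>If \<open>k > m\<close> there are no \<open>k\<close>-subsets of \<open>M\<close>; the only set to use is then \<open>M\<close> itself.\<close>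
  define r where "r = min k m"
  define P where "P = {\<sigma>. \<sigma> \<subseteq> M \<and> card \<sigma> = r}"
  have "finite P"
    using \<open>finite M\<close> by (simp add: P_def)
  have "\<exists>v. v \<in> V \<and> (\<forall>(A, B) \<in> \<sigma>. v \<notin> A)" if "\<sigma> \<in> P" for \<sigma>
  proof -
    have \<sigma>: "\<sigma> \<subseteq> \<tau>" "finite \<sigma>" "card \<sigma> \<le> k"
      using that \<open>M \<subseteq> \<tau>\<close> \<open>finite M\<close> by (auto simp: P_def r_def intro: finite_subset)
    then have "(\<Union>(A, B)\<in>\<sigma>. A) \<noteq> V"
      using assms(5) by (simp add: resilient_def)
    moreover have "(\<Union>(A, B)\<in>\<sigma>. A) \<subseteq> V"
      using \<sigma>(1) sub by auto
    ultimately show ?thesis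
      by blast
  qed
  then obtain x where x: "\<And>\<sigma>. \<sigma> \<in> P \<Longrightarrow> x \<sigma> \<in> V"
      and avoids: "\<And>\<sigma> A B. \<sigma> \<in> P \<Longrightarrow> (A, B) \<in> \<sigma> \<Longrightarrow> x \<sigma> \<notin> A"
    by atomize_elim (rule bchoice[THEN exE, of P "\<lambda>\<sigma> v. v \<in> V \<and> (\<forall>(A, B) \<in> \<sigma>. v \<notin> A)"]; blast)
  define w where "w = (\<lambda>v. real (card {\<sigma> \<in> P. x \<sigma> = v}))"
  have "induces w M"
    unfolding induces_def
  proof safe
    fix A B assume AB: "(A, B) \<in> M"
    then have V: "A \<union> B = V"
      using \<open>M \<subseteq> \<tau>\<close> sides by blast
    then have fin: "finite A" "finite B"
      using assms(1) by auto
    have "0 < card M"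
      using AB \<open>finite M\<close> by (auto simp: card_gt_0_iff)
    then have r: "r \<le> card M" "card M < 2 * r"
      using assms(4,6) by (auto simp: r_def M_def)
    have "card {\<sigma> \<in> P. x \<sigma> \<in> A} \<le> card {\<sigma>. \<sigma> \<subseteq> M \<and> card \<sigma> = r \<and> (A, B) \<notin> \<sigma>}"
      using \<open>finite M\<close> avoids by (intro card_mono) (auto simp: P_def)
    also have "\<dots> < card {\<sigma>. \<sigma> \<subseteq> M \<and> card \<sigma> = r \<and> (A, B) \<in> \<sigma>}"
      using more_subsets_contain_than_avoid[OF \<open>finite M\<close> AB r] .
    also have "\<dots> \<le> card {\<sigma> \<in> P. x \<sigma> \<in> B}"
    proof (rule card_mono)
      show "{\<sigma>. \<sigma> \<subseteq> M \<and> card \<sigma> = r \<and> (A, B) \<in> \<sigma>} \<subseteq> {\<sigma> \<in> P. x \<sigma> \<in> B}"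
        using x avoids V by (auto simp: P_def)
    qed (use \<open>finite P\<close> in simp)
    finally show "sum w A < sum w B"
      by (simp add: w_def sum_card_fibres \<open>finite P\<close> fin)
  qed
  moreover have "\<forall>v \<in> V. 0 \<le> w v"
    by (simp add: w_def)
  ultimately show ?thesis
    using induces_if_induces_maximal[OF assms(1) sub] by (auto simp: M_def)
qed

end
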